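(* Let $k\ge 1$ be fixed. For the MMB structure, let $\sigma(k,n)$ denote the number of hashes in the membership proof of the $k$-th newest item $x_{n-k+1}$ when $|X|=n\ge k$. Then its expected (amortized) value over $n$ satisfies $$\bar\sigma(k):=\lim_{N\to\infty}\frac1N\sum_{n=k}^{k+N-1}\sigma(k,n)\ \le\ \frac{11}{8}\log_2\!\left(\frac{k+1}{3}\right)+\frac92-\frac{9}{4(k+1)}.$$
   Context: $X=(x_1,x_2,\dots)$ is an append-only list; $X_n$ is its state with $n$ items; leaf $h_i$ corresponds to $x_i$. A mountain of height $s\ge0$ is a perfect binary tree with $2^s$ leaves; its root is its peak. The U-MMB for $X_n$ is an ordered (left-to-right) list of mountains whose leaves read left to right are $h_1,\dots,h_n$, built inductively from the empty list: to append, (1) add the new leaf as a height-0 mountain at the right end; (2) if some two consecutive mountains have equal height, take the rightmost such pair, of height $s$, and replace it in place by a mountain of height $s+1$ whose new peak has the two old peaks as children. The MMB partitions the mountain list into ranges: consecutive mountains $M,M'$ ($M$ left of $M'$) are in different ranges iff their heights differ by 2, or the mountain immediately left of $M$ exists and has the same height as $M$. For a range with peaks $P_1,\dots,P_r$ (left to right), range nodes are $R_1$ (single child $P_1$) and $R_j$ with children $R_{j-1},P_j$; $R_r$ is the range root. For range roots $Q_1,\dots,Q_q$ (left to right), belt nodes are $B_1$ (single child $Q_1$) and $B_j$ with children $B_{j-1},Q_j$; $B_q$ is the root. The membership proof of a leaf is the list of hashes of the siblings of the nodes on the path from the leaf to the root, where a node without sibling (child of a single-child node) contributes no hash. The paper's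 "expected proof size for fixed $k$ and variable $n$" is the limiting average $\bar\sigma(k)$ in the claim. *)

theory Defs
  imports "HOL-Analysis.Analysis"
begin

text \<open>All nodes of the structure: leaves \<open>h\<^sub>i\<close> are \<open>Leaf i\<close>; \<open>Unary\<close> is used for the first range
  node of a range and for the first belt node only.\<close>

datatype node = Leaf nat | Unary node | Binary node node

primrec leaves :: "node \<Rightarrow> nat list" where
  "leaves (Leaf i) = [i]"
| "leaves (Unary t) = leaves t"
| "leaves (Binary l r) = leaves l @ leaves r"

primrec node_height :: "node \<Rightarrow> nat" where
  "node_height (Leaf i) = 0"
| "node_height (Unary t) = Suc (node_height t)"
| "node_height (Binary l r) = Suc (max (node_height l) (node_height r))"

definition equal_pair_at :: "node list \<Rightarrow> nat \<Rightarrow> bool" where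
  "equal_pair_at ms j \<longleftrightarrow>
     Suc j < length ms \<and> node_height (ms ! j) = node_height (ms ! Suc j)"

definition merge_rightmost_pair :: "node list \<Rightarrow> node list" where
  "merge_rightmost_pair ms =
     (if \<exists>j. equal_pair_at ms j
      then let j = (GREATEST j. equal_pair_at ms j)
           in take j ms @ [Binary (ms ! j) (ms ! Suc j)] @ drop (j + 2) ms
      else ms)"

text \<open>The list of mountains for \<open>n\<close> items, left to right; a mountain is identified with its peak.\<close>

primrec u_mmb :: "nat \<Rightarrow> node list" where
  "u_mmb 0 = []"
| "u_mmb (Suc n) = merge_rightmost_pair (u_mmb n @ [Leaf (Suc n)])"

text \<open>Consecutive mountains \<open>m, m'\<close> lie in different ranges; \<open>p\<close> is the mountain immediately left
  of \<open>m\<close> in the whole mountain list, if there is one.\<close>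

definition range_boundary :: "node option \<Rightarrow> node \<Rightarrow> node \<Rightarrow> bool" where
  "range_boundary p m m' \<longleftrightarrow>
     \<bar>int (node_height m) - int (node_height m')\<bar> = 2 \<or>
     (\<exists>l. p = Some l \<and> node_height l = node_height m)"

fun split_ranges :: "node option \<Rightarrow> node list \<Rightarrow> node list list" where
  "split_ranges p [] = []"
| "split_ranges p [m] = [[m]]"
| "split_ranges p (m # m' # ms) =
     (let rs = split_ranges (Some m) (m' # ms)
      in if range_boundary p m m' then [m] # rs else (m # hd rs) # tl rs)"

definition mountain_ranges :: "nat \<Rightarrow> node list list" where
  "mountain_ranges n = split_ranges None (u_mmb n)"

text \<open>The last node of the chain \<open>C\<^sub>1 = Unary t\<^sub>1\<close>, \<open>C\<^sub>j = Binary C\<^bsub>j-1\<^esub> t\<^sub>j\<close>, used both for the range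
  nodes above the peaks of a range and for the belt nodes above the range roots; meaningful only for
  nonempty lists.\<close>

definition chain_root :: "node list \<Rightarrow> node" where
  "chain_root ts = foldl Binary (Unary (hd ts)) (tl ts)"

definition mmb_root :: "nat \<Rightarrow> node" where
  "mmb_root n = chain_root (map chain_root (mountain_ranges n))"

text \<open>The siblings met on the path from leaf \<open>i\<close> up to the root of the given tree. The membership
  proof consists of one hash for each of them, so the nodes themselves stand for their hashes.\<close>

primrec membership_proof :: "nat \<Rightarrow> node \<Rightarrow> node list" where
  "membership_proof i (Leaf j) = []"
| "membership_proof i (Unary t) = membership_proof i t"
| "membership_proof i (Binary l r) =
     (if i \<in> set (leaves l) then membership_proof i l @ [r] else membership_proof i r @ [l])"

text \<open>Meaningful for \<open>1 \<le> k \<le> n\<close>.\<close>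

definition proof_size :: "nat \<Rightarrow> nat \<Rightarrow> nat" where
  "proof_size k n = length (membership_proof (n - k + 1) (mmb_root n))"

definition average_proof_size :: "nat \<Rightarrow> nat \<Rightarrow> real" where
  "average_proof_size k N = 1 / real N * (\<Sum>n = k..<k + N. real (proof_size k n))"

definition expected_proof_size :: "nat \<Rightarrow> real" where
  "expected_proof_size k = lim (average_proof_size k)"

end

theory Submission
  imports Defs "HOL-Real_Asymp.Real_Asymp"
begin

text \<open>Put \<open>T = n + 1\<close>. The mountain list is the binary expansion of \<open>T\<close> without its leading one: digit
  \<open>b\<^sub>j\<close> is a mountain of height \<open>j + b\<^sub>j\<close>, and range boundaries are local patterns of three digits. If
  \<open>k + 1 = 2\<^sup>a + q\<close> with \<open>q < 2\<^sup>a\<close>, then the \<open>k\<close>-th newest leaf lies in mountain \<open>a\<close> when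
  \<open>T mod 2\<^sup>a < q\<close> and in mountain \<open>a - 1\<close> otherwise. Hence, up to a set of \<open>T\<close> of density zero on which
  there is no range further left, the proof size is a periodic function of \<open>T\<close>, and the limit is its mean
  over a period. Always taking mountain \<open>a - 1\<close> gives the mean \<open>11 a / 8 + 2 - 5 / (2 \<cdot> 2\<^sup>a)\<close>; the
  correction for \<open>T mod 2\<^sup>a < q\<close> is bounded by a piecewise linear function of \<open>q / 2\<^sup>a\<close>, which lies below
  the chords of the logarithm.\<close>

section \<open>The mountain list as a binary counter\<close>

primrec mountain :: "nat \<Rightarrow> nat \<Rightarrow> node" where
  "mountain 0 p = Leaf (Suc p)"
| "mountain (Suc s) p = Binary (mountain s p) (mountain s (p + 2 ^ s))"

lemma node_height_mountain [simp]: "node_height (mountain s p) = s"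
  by (induction s arbitrary: p) auto

lemma set_leaves_mountain [simp]: "set (leaves (mountain s p)) = {p<..p + 2 ^ s}"
  by (induction s arbitrary: p) auto

lemma length_membership_proof_mountain [simp]:
  "length (membership_proof i (mountain s p)) = s"
  by (induction s arbitrary: p) auto

text \<open>In the reversed list the newest mountain comes first, so structural recursion meets the
  rightmost pair first; the older mountain \<open>y\<close> becomes the left child.\<close>

fun merge_first_pair :: "node list \<Rightarrow> node list" where
  "merge_first_pair (x # y # zs) =
     (if node_height x = node_height y then Binary y x # zs else x # merge_first_pair (y # zs))"
| "merge_first_pair xs = xs"

lemma merge_rightmost_pair_snoc:
  assumes "node_height (last ms) \<noteq> node_height x" "ms \<noteq> []"
  shows "merge_rightmost_pair (ms @ [x]) = merge_rightmost_pair ms @ [x]"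
proof -
  have eq: "equal_pair_at (ms @ [x]) = equal_pair_at ms"
  proof
    fix j
    consider "Suc j < length ms" | "Suc j = length ms" | "Suc j > length ms" by linarith
    thus "equal_pair_at (ms @ [x]) j = equal_pair_at ms j"
    proof cases
      case 2
      hence "ms ! j = last ms" using assms(2) by (metis diff_Suc_1 last_conv_nth)
      thus ?thesis using 2 assms by (auto simp: equal_pair_at_def nth_append)
    qed (auto simp: equal_pair_at_def nth_append)
  qed
  show ?thesis
  proof (cases "\<exists>j. equal_pair_at ms j")
    case True
    define g where "g = (GREATEST j. equal_pair_at ms j)"
    have "equal_pair_at ms g"
      unfolding g_def using True
      by (rule exE) (rule GreatestI_nat[where b = "length ms"], auto simp: equal_pair_at_def)
    hence "Suc g < length ms" by (simp add: equal_pair_at_def)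
    thus ?thesis
      using True unfolding merge_rightmost_pair_def eq g_def[symmetric] Let_def
      by (simp add: nth_append)
  qed (simp add: merge_rightmost_pair_def eq)
qed

lemma merge_rightmost_pair_snoc2:
  assumes "node_height y = node_height x"
  shows "merge_rightmost_pair (ms @ [y, x]) = ms @ [Binary y x]"
proof -
  have at: "equal_pair_at (ms @ [y, x]) (length ms)"
    using assms by (simp add: equal_pair_at_def nth_append)
  have "(GREATEST j. equal_pair_at (ms @ [y, x]) j) = length ms"
    by (rule Greatest_equality) (use at in \<open>auto simp: equal_pair_at_def\<close>)
  thus ?thesis using at by (auto simp: merge_rightmost_pair_def nth_append)
qed

lemma merge_rightmost_pair_rev:
  "merge_rightmost_pair (rev xs) = rev (merge_first_pair xs)"
proof (induction xs rule: merge_first_pair.induct)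
  case (1 x y zs)
  show ?case
  proof (cases "node_height x = node_height y")
    case True
    thus ?thesis using merge_rightmost_pair_snoc2[of y x "rev zs"] by simp
  next
    case False
    thus ?thesis using 1 merge_rightmost_pair_snoc[of "rev (y # zs)" x] by simp
  qed
qed (simp_all add: merge_rightmost_pair_def equal_pair_at_def)

text \<open>For \<open>s = 0\<close> and \<open>T = n + 1\<close> this is the mountain list of \<open>n\<close> items, read from right to left:
  below its leading one, \<open>T\<close> has one binary digit per mountain, and digit \<open>b\<close> at position \<open>j\<close> stands
  for a mountain of height \<open>j + b\<close>.\<close>

fun mountains_from :: "nat \<Rightarrow> nat \<Rightarrow> node list" where
  "mountains_from s T = (if T \<le> 1 then [] else
     mountain (s + T mod 2) (2 ^ Suc s * (T div 2 - 1)) # mountains_from (Suc s) (T div 2))"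

declare mountains_from.simps [simp del]

text \<open>Appending is binary increment. An even \<open>T\<close> absorbs the incoming mountain,
  turning digit 0 into 1. For odd \<open>T\<close> the incoming mountain stays as digit 0, and its
  neighbour of height \<open>Suc s\<close> plays the incoming role one position higher: the
  carry.\<close>

lemma merge_first_pair_mountains_from:
  "T \<ge> 1 \<Longrightarrow>
   merge_first_pair (mountain s (2 ^ s * (T - 1)) # mountains_from s T) = mountains_from s (Suc T)"
proof (induction T arbitrary: s rule: less_induct)
  case (less T)
  show ?case
  proof (cases "T = 1")
    case True
    thus ?thesis by (simp add: mountains_from.simps[of s] mountains_from.simps[of "Suc s"])
  next
    case False
    with less.prems have T: "T \<ge> 2" by simp
    show ?thesis
    proof (cases "even T")
      case True
      hence "\<exists>S. T = 2 * Suc S" using T by presburger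
      then obtain S where S: "T = 2 * Suc S" ..
      have "Suc (2 * Suc S) mod 2 = 1" by presburger
      thus ?thesis
        by (simp add: S mountains_from.simps[of s] algebra_simps)
    next
      case False
      hence "\<exists>S. T = 2 * Suc S + 1" using T by presburger
      then obtain S where S: "T = 2 * Suc S + 1" ..
      have "merge_first_pair (mountain (Suc s) (2 ^ Suc s * (Suc S - 1)) # mountains_from (Suc s) (Suc S))
         = mountains_from (Suc s) (Suc (Suc S))"
        by (rule less.IH) (simp_all add: S)
      moreover have "Suc (2 * Suc S) mod 2 = 1" by presburger
      ultimately show ?thesis
        by (simp add: S mountains_from.simps[of s] algebra_simps)
    qed
  qed
qed

lemma rev_u_mmb: "rev (u_mmb n) = mountains_from 0 (Suc n)"
proof (induction n)
  case 0
  show ?case by (simp add: mountains_from.simps)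
next
  case (Suc n)
  have "rev (u_mmb (Suc n)) = merge_first_pair (Leaf (Suc n) # rev (u_mmb n))"
    using merge_rightmost_pair_rev[of "Leaf (Suc n) # rev (u_mmb n)"] by simp
  thus ?case
    using Suc merge_first_pair_mountains_from[of "Suc n" 0] by simp
qed

definition mountain_at :: "nat \<Rightarrow> nat \<Rightarrow> node" where
  "mountain_at T j = mountain (j + of_bool (bit T j)) (2 ^ Suc j * (T div 2 ^ Suc j - 1))"

text \<open>\<open>m\<close> is the position of the leading one of \<open>T\<close>, which carries
  no mountain, and hence the number of mountains.\<close>

lemma mountains_from_eq_map:
  assumes "2 ^ m \<le> T" "T < 2 ^ Suc m"
  shows "mountains_from s T =
    map (\<lambda>j. mountain (s + j + of_bool (bit T j)) (2 ^ Suc (s + j) * (T div 2 ^ Suc j - 1))) [0..<m]"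
  using assms
proof (induction m arbitrary: s T)
  case 0
  thus ?case by (simp add: mountains_from.simps)
next
  case (Suc m)
  have "(1::nat) < 2 ^ Suc m" by (rule one_less_power) simp_all
  hence T: "T > 1" "2 ^ m \<le> T div 2" "T div 2 < 2 ^ Suc m"
    using Suc.prems by auto
  have "[0..<Suc m] = 0 # map Suc [0..<m]"
    by (simp add: map_Suc_upt upt_conv_Cons)
  thus ?case
    using T(1) Suc.IH[OF T(2,3), of "Suc s"]
    by (simp add: mountains_from.simps[of s T] bit_Suc bit_0 div_mult2_eq mod_2_eq_odd comp_def)
qed

lemma u_mmb_eq_map:
  assumes "2 ^ m \<le> Suc n" "Suc n < 2 ^ Suc m"
  shows "u_mmb n = map (mountain_at (Suc n)) (rev [0..<m])"
proof -
  have "rev (u_mmb n) = map (mountain_at (Suc n)) [0..<m]"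
    using mountains_from_eq_map[OF assms, of 0] by (simp add: rev_u_mmb mountain_at_def)
  thus ?thesis by (metis rev_map rev_rev_ident)
qed

section \<open>Ranges read off from three consecutive digits\<close>

text \<open>Mountains are indexed from the right, starting at 0. \<open>boundary_bit T j\<close> says that the mountains
  \<open>j + 1\<close> and \<open>j\<close> lie in different ranges; \<open>run_length T i\<close> counts the mountains to the right of
  mountain \<open>i\<close> within its range, and \<open>boundary_count T i\<close> the ranges to the right of that range. At the
  left end the missing neighbour is replaced correctly by the leading one of \<open>T\<close>.\<close>

definition boundary_bit :: "nat \<Rightarrow> nat \<Rightarrow> bool" where
  "boundary_bit T j \<longleftrightarrow> bit T (Suc j) \<and> \<not> bit T j \<or> \<not> bit T (Suc (Suc j)) \<and> bit T (Suc j)"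

primrec run_length :: "nat \<Rightarrow> nat \<Rightarrow> nat" where
  "run_length T 0 = 0"
| "run_length T (Suc i) = (if boundary_bit T i then 0 else Suc (run_length T i))"

definition boundary_count :: "nat \<Rightarrow> nat \<Rightarrow> nat" where
  "boundary_count T i = (\<Sum>j<i. of_bool (boundary_bit T j))"

definition left_neighbour :: "nat \<Rightarrow> nat \<Rightarrow> nat \<Rightarrow> node option" where
  "left_neighbour T m i = (if Suc i < m then Some (mountain_at T (Suc i)) else None)"

text \<open>The heights of mountains \<open>Suc j\<close> and \<open>j\<close> differ by 1 plus the
  digit at \<open>Suc j\<close> minus the digit at \<open>j\<close>: by 2 exactly for digits 10, by
  0 exactly for 01. The second case is applied one position higher.\<close>

lemma range_boundary_mountain_at:
  assumes "2 ^ m \<le> T" "T < 2 ^ Suc m" "Suc j < m"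
  shows "range_boundary (left_neighbour T m (Suc j)) (mountain_at T (Suc j)) (mountain_at T j)
    \<longleftrightarrow> boundary_bit T j"
proof -
  have "bit T m"
  proof -
    have "T div 2 ^ m = 1" using assms by (intro div_nat_eqI) auto
    thus ?thesis by (simp add: bit_iff_odd)
  qed
  hence "Suc (Suc j) = m \<Longrightarrow> bit T (Suc (Suc j))" by simp
  moreover have "\<not> Suc (Suc j) < m \<Longrightarrow> Suc (Suc j) = m" using assms(3) by simp
  ultimately show ?thesis
    by (auto simp: range_boundary_def left_neighbour_def mountain_at_def boundary_bit_def)
qed

lemma split_ranges_right:
  assumes "2 ^ m \<le> T" "T < 2 ^ Suc m" "i < m"
  shows "\<exists>R C. split_ranges (left_neighbour T m i) (map (mountain_at T) (rev [0..<Suc i])) =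
    (mountain_at T i # R) # C \<and> length R = run_length T i \<and> length C = boundary_count T i"
  using assms(3)
proof (induction i)
  case 0
  show ?case by (simp add: boundary_count_def)
next
  case (Suc i)
  then obtain R C where "split_ranges (left_neighbour T m i)
      (map (mountain_at T) (rev [0..<Suc i])) = (mountain_at T i # R) # C"
    "length R = run_length T i" "length C = boundary_count T i"
    by force
  thus ?case
    using Suc.prems range_boundary_mountain_at[OF assms(1,2), of i]
    by (simp add: left_neighbour_def boundary_count_def)
qed

text \<open>On the left only the emptiness of \<open>R1\<close> and \<open>A\<close> is recorded,
  because everything to the left in a chain is gathered under a single sibling.\<close>

lemma split_ranges_shape:
  assumes "2 ^ m \<le> T" "T < 2 ^ Suc m" "i + d < m"
  shows "\<exists>A R1 R2 C. split_ranges (left_neighbour T m (i + d))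
      (map (mountain_at T) (rev [0..<Suc (i + d)])) = A @ (R1 @ mountain_at T i # R2) # C \<and>
    length R2 = run_length T i \<and> length C = boundary_count T i \<and>
    (R1 = [] \<longleftrightarrow> d = 0 \<or> boundary_bit T i) \<and>
    (A = [] \<longleftrightarrow> (\<forall>j\<in>{i..<i + d}. \<not> boundary_bit T j))"
  using assms(3)
proof (induction d)
  case 0
  then obtain R C where "split_ranges (left_neighbour T m i)
      (map (mountain_at T) (rev [0..<Suc i])) = (mountain_at T i # R) # C"
    "length R = run_length T i" "length C = boundary_count T i"
    using split_ranges_right[OF assms(1,2)] by force
  thus ?case by (intro exI[of _ "[]"] exI[of _ R] exI[of _ C]) simp
next
  case (Suc d)
  let ?M = "mountain_at T" and ?d = "i + d"
  from Suc obtain A R1 R2 C where IH: "split_ranges (left_neighbour T m ?d)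
      (map ?M (rev [0..<Suc ?d])) = A @ (R1 @ ?M i # R2) # C"
    "length R2 = run_length T i" "length C = boundary_count T i"
    "R1 = [] \<longleftrightarrow> d = 0 \<or> boundary_bit T i"
    "A = [] \<longleftrightarrow> (\<forall>j\<in>{i..<?d}. \<not> boundary_bit T j)"
    by force
  let ?rs = "A @ (R1 @ ?M i # R2) # C"
  have split: "split_ranges (left_neighbour T m (Suc ?d)) (map ?M (rev [0..<Suc (Suc ?d)])) =
    (if boundary_bit T ?d then [?M (Suc ?d)] # ?rs else (?M (Suc ?d) # hd ?rs) # tl ?rs)"
    using Suc.prems range_boundary_mountain_at[OF assms(1,2), of ?d] IH(1)
    by (simp add: left_neighbour_def Let_def)
  have range_Suc: "{i..<i + Suc d} = insert ?d {i..<?d}" by auto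
  show ?case
  proof (cases "boundary_bit T ?d")
    case True
    thus ?thesis using split IH unfolding range_Suc
      by (intro exI[of _ "[?M (Suc ?d)] # A"] exI[of _ R1] exI[of _ R2] exI[of _ C])
        (cases d; auto)
  next
    case False
    show ?thesis
    proof (cases A)
      case Nil
      hence "\<not> boundary_bit T i" using False IH(5) by (cases d) auto
      thus ?thesis using split False IH Nil unfolding range_Suc
        by (intro exI[of _ "[]"] exI[of _ "?M (Suc ?d) # R1"] exI[of _ R2] exI[of _ C]) auto
    next
      case (Cons x A')
      hence "d \<noteq> 0" using IH(5) by (cases d) auto
      thus ?thesis using split False IH Cons unfolding range_Suc
        by (intro exI[of _ "(?M (Suc ?d) # x) # A'"] exI[of _ R1] exI[of _ R2] exI[of _ C]) auto
    qed
  qed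
qed

section \<open>Chains, leaf positions and the formula for the proof size\<close>

lemma chain_root_snoc: "ts \<noteq> [] \<Longrightarrow> chain_root (ts @ [x]) = Binary (chain_root ts) x"
  by (simp add: chain_root_def)

lemma set_leaves_chain_root:
  "ts \<noteq> [] \<Longrightarrow> set (leaves (chain_root ts)) = (\<Union>t\<in>set ts. set (leaves t))"
proof (induction ts rule: rev_induct)
  case (snoc x ts)
  thus ?case by (cases "ts = []") (auto simp: chain_root_snoc chain_root_def)
qed simp

text \<open>A chain is a left comb: each tree of \<open>vs\<close> is a sibling on the path, while
  all of \<open>us\<close> sits below one sibling. The trees in \<open>us\<close> must avoid
  \<open>i\<close> since \<open>membership_proof\<close> descends to the left whenever it
  can.\<close>

lemma length_membership_proof_chain_root:
  assumes "i \<in> set (leaves t)" "\<And>u. u \<in> set us \<Longrightarrow> i \<notin> set (leaves u)"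
  shows "length (membership_proof i (chain_root (us @ t # vs))) =
    length (membership_proof i t) + length vs + of_bool (us \<noteq> [])"
proof (induction vs rule: rev_induct)
  case Nil
  show ?case
    using assms by (cases "us = []") (auto simp: chain_root_snoc set_leaves_chain_root, simp add: chain_root_def)
next
  case (snoc v vs)
  have "chain_root (us @ t # vs @ [v]) = Binary (chain_root (us @ t # vs)) v"
    using chain_root_snoc[of "us @ t # vs" v] by simp
  moreover have "i \<in> set (leaves (chain_root (us @ t # vs)))"
    using assms(1) by (subst set_leaves_chain_root) auto
  ultimately show ?case using snoc by simp
qed

lemma concat_split_ranges: "concat (split_ranges p ms) = ms \<and> [] \<notin> set (split_ranges p ms)"
proof (induction p ms rule: split_ranges.induct)
  case (3 p m m' ms)
  then obtain r rs where "split_ranges (Some m) (m' # ms) = r # rs"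
    by (cases "split_ranges (Some m) (m' # ms)") auto
  thus ?case using 3 by (auto simp: Let_def)
qed auto

text \<open>The right end is the left end for index \<open>j - 1\<close>, so the mountains tile an
  interval; for \<open>j = 0\<close> it is \<open>T - 1\<close>, the newest item.\<close>

lemma set_leaves_mountain_at:
  assumes "2 ^ Suc j \<le> T"
  shows "set (leaves (mountain_at T j)) =
    {2 ^ Suc j * (T div 2 ^ Suc j - 1)<..2 ^ j * (T div 2 ^ j - 1)}"
proof -
  define S where "S = T div 2 ^ Suc j"
  have "S \<ge> 1" using assms div_le_mono[OF assms, of "2 ^ Suc j"] by (simp add: S_def)
  then obtain S' where S': "S = Suc S'" by (cases S) auto
  have "T div 2 ^ j = 2 * S + of_bool (bit T j)"
    using div_mult_mod_eq[of "T div 2 ^ j" 2]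
    by (simp add: S_def bit_iff_odd mod_2_eq_odd power_Suc2 div_mult2_eq del: power_Suc)
  hence "2 ^ Suc j * (S - 1) + 2 ^ (j + of_bool (bit T j)) = 2 ^ j * (T div 2 ^ j - 1)"
    by (cases "bit T j") (simp_all add: S' algebra_simps)
  thus ?thesis by (simp add: mountain_at_def S_def)
qed

lemma disjoint_leaves_mountain_at:
  assumes "i < j" "2 ^ Suc j \<le> T"
  shows "set (leaves (mountain_at T i)) \<inter> set (leaves (mountain_at T j)) = {}"
proof -
  have pow: "(2::nat) ^ Suc i \<le> 2 ^ j" using assms(1) by (intro power_increasing) auto
  obtain c where c: "j = Suc i + c" using assms(1) by (metis less_iff_Suc_add add_Suc)
  have "2 ^ j * (T div 2 ^ j) = 2 ^ Suc i * (2 ^ c * (T div 2 ^ Suc i div 2 ^ c))"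
    by (simp only: c power_add div_mult2_eq mult.assoc)
  also have "\<dots> \<le> 2 ^ Suc i * (T div 2 ^ Suc i)"
    by (intro mult_left_mono) simp_all
  finally have "2 ^ j * (T div 2 ^ j - 1) \<le> 2 ^ Suc i * (T div 2 ^ Suc i - 1)"
    using pow by (simp add: diff_mult_distrib2 diff_le_mono2 order.trans[OF diff_le_mono])
  moreover have "(2::nat) ^ Suc i \<le> T"
    using order.trans[OF pow] assms(2) by simp
  ultimately show ?thesis using assms by (auto simp: set_leaves_mountain_at)
qed

text \<open>The summands are the height of the mountain (the first two), the right siblings in the
  range, those in the belt, and the one possible left sibling in the range and in the belt.\<close>

lemma proof_size_eq:
  assumes m: "2 ^ m \<le> Suc n" "Suc n < 2 ^ Suc m" and i: "i < m"
    and leaf: "Suc n - k \<in> set (leaves (mountain_at (Suc n) i))" and "k \<le> n"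
  shows "proof_size k n = i + of_bool (bit (Suc n) i) + run_length (Suc n) i
    + boundary_count (Suc n) i + of_bool (Suc i < m \<and> \<not> boundary_bit (Suc n) i)
    + of_bool (\<exists>j\<in>{i..<m - 1}. boundary_bit (Suc n) j)"
proof -
  let ?T = "Suc n"
  have le: "2 ^ Suc z \<le> ?T" if "z < m" for z
    using m(1) that by (intro order.trans[OF power_increasing[of "Suc z" m]]) auto
  obtain d where d: "m = Suc (i + d)" using i by (metis less_iff_Suc_add)
  have none: "left_neighbour ?T m (i + d) = None" by (simp add: left_neighbour_def d)
  have ranges: "mountain_ranges n = split_ranges (left_neighbour ?T m (i + d))
      (map (mountain_at ?T) (rev [0..<Suc (i + d)]))"
    unfolding mountain_ranges_def u_mmb_eq_map[OF m] none d[symmetric] ..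
  have "i + d < m" by (simp add: d)
  obtain A R1 R2 C where rs: "mountain_ranges n = A @ (R1 @ mountain_at ?T i # R2) # C"
    and len: "length R2 = run_length ?T i" "length C = boundary_count ?T i"
    and R1: "R1 = [] \<longleftrightarrow> d = 0 \<or> boundary_bit ?T i"
    and A: "A = [] \<longleftrightarrow> (\<forall>j\<in>{i..<i + d}. \<not> boundary_bit ?T j)"
    using split_ranges_shape[OF m \<open>i + d < m\<close>] unfolding ranges by blast
  have whole: "concat A @ R1 @ mountain_at ?T i # R2 @ concat C = map (mountain_at ?T) (rev [0..<m])"
    using concat_split_ranges[of None "u_mmb n"] rs
    by (simp add: mountain_ranges_def u_mmb_eq_map[OF m])
  have nonempty: "[] \<notin> set (mountain_ranges n)"
    using concat_split_ranges by (simp add: mountain_ranges_def)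
  \<comment> \<open>Without repetitions mountain \<open>i\<close> does not recur to its own left, so
    disjointness keeps the leaf out of all trees there.\<close>
  have "distinct (map (mountain_at ?T) (rev [0..<m]))"
    unfolding distinct_map
  proof (intro conjI inj_onI)
    fix x y assume xy: "x \<in> set (rev [0..<m])" "y \<in> set (rev [0..<m])"
      and eq: "mountain_at ?T x = mountain_at ?T y"
    have ne: "set (leaves t) \<noteq> {}" for t by (induction t) auto
    show "x = y"
      using disjoint_leaves_mountain_at[OF _ le, of x y] disjoint_leaves_mountain_at[OF _ le, of y x]
        xy eq ne by (cases x y rule: linorder_cases) auto
  qed simp
  hence "mountain_at ?T i \<notin> set (concat A @ R1)" unfolding whole[symmetric] by auto
  moreover have "set (concat A @ R1) \<subseteq> mountain_at ?T ` {..<m}"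
  proof -
    have "set (concat A @ R1) \<subseteq> set (map (mountain_at ?T) (rev [0..<m]))"
      unfolding whole[symmetric] by auto
    thus ?thesis by auto
  qed
  ultimately have other: "?T - k \<notin> set (leaves u)" if u: "u \<in> set (concat A @ R1)" for u
  proof -
    have "u \<in> mountain_at ?T ` {..<m}" "u \<noteq> mountain_at ?T i"
      using u \<open>mountain_at ?T i \<notin> _\<close> \<open>set (concat A @ R1) \<subseteq> _\<close> by blast+
    then obtain j where j: "u = mountain_at ?T j" "j < m" "j \<noteq> i" by blast
    show ?thesis
      using disjoint_leaves_mountain_at[OF _ le, of i j] disjoint_leaves_mountain_at[OF _ le, of j i]
        i j leaf by (cases i j rule: linorder_cases) auto
  qed
  let ?Q = "chain_root (R1 @ mountain_at ?T i # R2)"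
  have inQ: "?T - k \<in> set (leaves ?Q)"
    using leaf by (subst set_leaves_chain_root) auto
  have "?T - k \<notin> set (leaves u)" if u: "u \<in> set (map chain_root A)" for u
  proof -
    from u obtain r where r: "r \<in> set A" "u = chain_root r" by auto
    hence "r \<noteq> []" using nonempty rs by auto
    thus ?thesis using r other by (auto simp: set_leaves_chain_root)
  qed
  from length_membership_proof_chain_root[OF inQ this, of "map chain_root A" "map chain_root C"]
  have "length (membership_proof (?T - k) (mmb_root n)) =
      length (membership_proof (?T - k) ?Q) + length C + of_bool (A \<noteq> [])"
    by (simp add: mmb_root_def rs)
  also have "length (membership_proof (?T - k) ?Q) =
      i + of_bool (bit ?T i) + length R2 + of_bool (R1 \<noteq> [])"
    using length_membership_proof_chain_root[OF leaf, of R1 R2] other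
    by (simp add: mountain_at_def)
  finally have *: "proof_size k n = i + of_bool (bit ?T i) + length R2 + of_bool (R1 \<noteq> [])
      + length C + of_bool (A \<noteq> [])"
    using \<open>k \<le> n\<close> by (simp add: proof_size_def Suc_diff_le)
  have "(R1 \<noteq> []) = (Suc i < m \<and> \<not> boundary_bit ?T i)" unfolding R1 d by auto
  moreover have "(A \<noteq> []) = (\<exists>j\<in>{i..<m - 1}. boundary_bit ?T j)" unfolding A d by auto
  ultimately show ?thesis unfolding * len by simp
qed

text \<open>Exactly \<open>2 ^ i + T mod 2 ^ i - 1\<close> leaves are newer than mountain
  \<open>i\<close>. The hypotheses put this number below \<open>k\<close> for \<open>i\<close>, and
  at least at \<open>k\<close> for \<open>Suc i\<close>.\<close>

lemma leaf_in_mountain_at: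
  assumes "k < T" "2 ^ Suc i \<le> T" "2 ^ i + T mod 2 ^ i \<le> k" "k < 2 ^ Suc i + T mod 2 ^ Suc i"
  shows "T - k \<in> set (leaves (mountain_at T i))"
proof -
  have *: "2 ^ j * (T div 2 ^ j - 1) = T - T mod 2 ^ j - 2 ^ j" for j
    by (simp add: diff_mult_distrib2 minus_mod_eq_mult_div)
  have "T mod 2 ^ i \<le> T" "T mod 2 ^ Suc i \<le> T" by simp_all
  thus ?thesis
    unfolding set_leaves_mountain_at[OF assms(2)] * using assms by auto
qed

section \<open>Separating low digits from high digits\<close>

lemma bit_add_mult_low: "j < a \<Longrightarrow> bit (U + 2 ^ a * v) j = bit (U :: nat) j"
proof -
  assume "j < a"
  then obtain d where d: "a = j + Suc d" by (metis less_iff_Suc_add add_Suc_right)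
  have "(U + 2 ^ a * v) div 2 ^ j = U div 2 ^ j + 2 * (2 ^ d * v)"
    using div_mult_self2[of "2 ^ j" U "2 * (2 ^ d * v)"]
    by (simp add: d power_add mult_ac)
  thus ?thesis by (simp add: bit_iff_odd)
qed

lemma bit_add_mult_high: "U < 2 ^ a \<Longrightarrow> bit (U + 2 ^ a * v) (a + j) = bit (v :: nat) j"
  by (simp add: bit_iff_odd power_add div_mult2_eq)

lemma boundary_bit_low: "j + 2 < L \<Longrightarrow> boundary_bit (U + 2 ^ L * w) j = boundary_bit U j"
  by (simp add: boundary_bit_def bit_add_mult_low)

lemma boundary_bit_high:
  "U < 2 ^ a \<Longrightarrow> boundary_bit (U + 2 ^ a * v) (a + j) = boundary_bit v j"
  using bit_add_mult_high[of U a v j] bit_add_mult_high[of U a v "Suc j"]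
    bit_add_mult_high[of U a v "Suc (Suc j)"]
  by (simp add: boundary_bit_def)

lemma run_length_low: "i + 1 < L \<Longrightarrow> run_length (U + 2 ^ L * w) i = run_length U i"
  by (induction i) (simp_all add: boundary_bit_low)

lemma boundary_count_low: "i + 1 < L \<Longrightarrow> boundary_count (U + 2 ^ L * w) i = boundary_count U i"
  by (simp add: boundary_count_def boundary_bit_low)

text \<open>The proof size of a leaf below the mountain with index \<open>i\<close> when there are further ranges to
  the left of that mountain's range.\<close>

definition inner_proof_size :: "nat \<Rightarrow> nat \<Rightarrow> real" where
  "inner_proof_size T i = real i + of_bool (bit T i) + real (run_length T i)
     + real (boundary_count T i) + of_bool (\<not> boundary_bit T i) + 1"

lemma inner_proof_size_low:
  "i + 2 < L \<Longrightarrow> inner_proof_size (U + 2 ^ L * w) i = inner_proof_size U i"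
  by (simp add: inner_proof_size_def bit_add_mult_low run_length_low boundary_count_low
      boundary_bit_low)

section \<open>Sums over a period\<close>

lemma sum_blocks: "(\<Sum>T<n * c. f T) = (\<Sum>v<c. \<Sum>U<n. f (U + n * v))" for n c :: nat
proof -
  have "(\<Sum>T<n * c. f T) = (\<Sum>v<c. sum f {v * n..<v * n + n})"
    by (simp add: sum.nat_group mult.commute)
  also have "\<dots> = (\<Sum>v<c. \<Sum>U<n. f (U + n * v))"
  proof (rule sum.cong)
    fix v
    show "sum f {v * n..<v * n + n} = (\<Sum>U<n. f (U + n * v))"
      using sum.shift_bounds_nat_ivl[of f 0 "v * n" n]
      by (simp add: lessThan_atLeast0 add.commute mult.commute)
  qed simp
  finally show ?thesis .
qed

text \<open>Here \<open>v\<close> fixes the digits from position \<open>i\<close> on. Reading downwards, a range continues after the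
  digits \<open>00\<close> and \<open>10\<close>, after \<open>11\<close> only if the next digit is 1, and never after \<open>01\<close>; so only the lowest
  two digits of \<open>v\<close> matter.\<close>

lemma sum_run_length_fixed:
  "(\<Sum>U<2 ^ i. real (run_length (U + 2 ^ i * v) i)) =
    (if v mod 4 = 1 then 0 else if v mod 4 = 3 then 2 ^ i - 1 else 2 * 2 ^ i - 2)"
proof (induction i arbitrary: v)
  case 0
  show ?case by simp
next
  case (Suc i)
  \<comment> \<open>The digit \<open>b\<close> at position \<open>i\<close> is split off and joins
    the fixed digits as \<open>b + 2 * v\<close>.\<close>
  have "(\<Sum>U<2 ^ Suc i. real (run_length (U + 2 ^ Suc i * v) (Suc i))) =
    (\<Sum>b<2. \<Sum>U<2 ^ i. real (run_length (U + 2 ^ i * (b + 2 * v)) (Suc i)))"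
    using sum_blocks[of "\<lambda>U. real (run_length (U + 2 ^ Suc i * v) (Suc i))" "2 ^ i" 2]
    by (simp add: algebra_simps)
  also have "\<dots> = (\<Sum>b<2. if boundary_bit (b + 2 * v) 0 then 0 else
      2 ^ i + (\<Sum>U<2 ^ i. real (run_length (U + 2 ^ i * (b + 2 * v)) i)))"
    using boundary_bit_high[of _ i _ 0] by (intro sum.cong) (auto simp: sum.distrib)
  also have "\<dots> = (if v mod 4 = 1 then 0 else if v mod 4 = 3 then 2 ^ Suc i - 1
      else 2 * 2 ^ Suc i - 2)"
  proof -
    have bd: "boundary_bit (2 * v) 0 = odd v"
      "boundary_bit (Suc (2 * v)) 0 = (odd v \<and> even (v div 2))"
      by (auto simp: boundary_bit_def bit_Suc bit_0)
    have md: "2 * v mod 4 = 2 * (v mod 2)" "Suc (2 * v) mod 4 = Suc (2 * (v mod 2))"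
      by presburger+
    have v: "v mod 4 = 0 \<and> v mod 2 = 0 \<or> v mod 4 = 1 \<and> v mod 2 = 1 \<and> even (v div 2) \<or>
        v mod 4 = 2 \<and> v mod 2 = 0 \<or> v mod 4 = 3 \<and> v mod 2 = 1 \<and> odd (v div 2)"
      by presburger
    thus ?thesis unfolding Suc
      by (elim disjE conjE) (simp_all add: lessThan_nat_numeral numeral_2_eq_2[symmetric] bd md odd_iff_mod_2_eq_one even_iff_mod_2_eq_zero)
  qed
  finally show ?case .
qed

text \<open>The length \<open>2 ^ i * 16\<close> is a common period for the indices \<open>i\<close>
  and \<open>Suc i\<close>, which involve digits up to \<open>i + 3\<close>. Of the 16 blocks, eight
  contribute \<open>2 * 2 ^ i - 2\<close> and four \<open>2 ^ i - 1\<close>.\<close>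

lemma sum_run_length:
  "(\<Sum>T<2 ^ i * 16. real (run_length T i)) = 20 * (2 ^ i - 1)"
  unfolding sum_blocks sum_run_length_fixed by (simp add: lessThan_nat_numeral algebra_simps)

lemma sum_bit: "(\<Sum>T<2 ^ i * 16. of_bool (bit (T :: nat) i) :: real) = 8 * 2 ^ i"
proof -
  have "(\<Sum>T<2 ^ i * 16. of_bool (bit (T :: nat) i) :: real) = (\<Sum>v<16. 2 ^ i * of_bool (bit (v :: nat) 0))"
    unfolding sum_blocks using bit_add_mult_high[of _ i _ 0] by simp
  also have "\<dots> = 8 * 2 ^ i"
    by (simp add: lessThan_nat_numeral lessThan_Suc bit_0 del: sum_of_bool_eq sum_mult_of_bool_eq)
  finally show ?thesis .
qed

text \<open>Three of the eight digit patterns at positions \<open>j + 2\<close>,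
  \<open>j + 1\<close>, \<open>j\<close> are boundaries: 010, 011 and 110.\<close>

lemma sum_boundary_bit:
  "(\<Sum>T<2 ^ j * (8 * 2 ^ d). of_bool (boundary_bit T j) :: real) = 3 * 2 ^ (j + d)"
proof -
  have "(\<Sum>T<2 ^ j * (8 * 2 ^ d). of_bool (boundary_bit T j) :: real) =
      2 ^ j * (\<Sum>v<8 * 2 ^ d. of_bool (boundary_bit v 0))"
    unfolding sum_blocks[of _ "2 ^ j"] using boundary_bit_high[of _ j _ 0]
    by (simp add: sum_distrib_left)
  also have "(\<Sum>v<8 * 2 ^ d. of_bool (boundary_bit v 0) :: real) =
      (\<Sum>w<2 ^ d. \<Sum>u<8. of_bool (boundary_bit (u + 2 ^ 3 * w) 0))"
    unfolding sum_blocks by simp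
  also have "\<dots> = (\<Sum>w<(2 :: nat) ^ d. \<Sum>u<8. of_bool (boundary_bit u 0))"
    using boundary_bit_low[of 0 3] by simp
  also have "\<dots> = 3 * 2 ^ d"
    by (simp add: lessThan_nat_numeral boundary_bit_def bit_Suc bit_0)
  finally show ?thesis by (simp add: power_add)
qed

lemma sum_boundary_count:
  "(\<Sum>T<2 ^ i * 16. real (boundary_count T i)) = 6 * real i * 2 ^ i"
proof -
  have "(\<Sum>T<2 ^ i * 16. of_bool (boundary_bit T j) :: real) = 6 * 2 ^ i" if "j < i" for j
  proof -
    have "(2::nat) ^ i * 16 = 2 ^ j * (8 * 2 ^ Suc (i - j))" "j + Suc (i - j) = Suc i"
      using that by (simp_all flip: power_add)
    thus ?thesis by (simp only: sum_boundary_bit) simp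
  qed
  thus ?thesis
    unfolding boundary_count_def of_nat_sum of_nat_of_bool by (subst sum.swap) simp
qed

text \<open>Per level the mean grows by 22/16: one for the height and 3/8 for the boundaries. The
  constant is 54 = 8 + 20 + 10 + 16, from the digit, the run length, the left sibling in the range
  and the one in the belt.\<close>

lemma sum_inner_proof_size:
  "(\<Sum>T<2 ^ i * 16. inner_proof_size T i) = 2 ^ i * (22 * real i + 54) - 20"
proof -
  have "(\<Sum>T<2 ^ i * 16. of_bool (\<not> boundary_bit T i) :: real) =
      2 ^ i * 16 - (\<Sum>T<2 ^ i * (8 * 2 ^ 1). of_bool (boundary_bit T i))"
    by (simp add: of_bool_not_iff sum_subtractf)
  thus ?thesis
    unfolding inner_proof_size_def sum.distrib sum_boundary_bit sum_boundary_count sum_bit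
      sum_run_length by (simp add: algebra_simps)
qed

section \<open>The change from mountain \<open>i\<close> to mountain \<open>Suc i\<close>\<close>

lemma inner_proof_size_Suc:
  "inner_proof_size T (Suc i) - inner_proof_size T i = 2 + of_bool (bit T (Suc i)) - of_bool (bit T i)
    - of_bool (boundary_bit T i) * real (run_length T i) - of_bool (boundary_bit T (Suc i))
    + of_bool (boundary_bit T i)"
  by (simp add: inner_proof_size_def boundary_count_def)

text \<open>A boundary needs digit 1 at its middle position, so digit 0 at \<open>i\<close>
  continues the range by one mountain, and digit 0 at \<open>i - 1\<close> by another.\<close>

lemma run_length_ge:
  assumes "bit T (Suc i)" "\<not> bit T i"
  shows "of_bool (1 \<le> i) + of_bool (2 \<le> i \<and> \<not> bit T (i - 1)) \<le> run_length T i"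
proof (cases i)
  case (Suc i')
  thus ?thesis using assms by (cases i') (auto simp: boundary_bit_def)
qed simp

text \<open>\<open>U\<close> fixes the digits up to \<open>i\<close>; \<open>v\<close> runs through
  the next three. With digit 0 at \<open>i\<close>, each of the four odd \<open>v\<close> gives a
  boundary that cuts off a run bounded below by \<open>run_length_ge\<close>. With digit 1 the run
  cut off is estimated by 0.\<close>

lemma sum_inner_proof_size_diff:
  assumes U: "U < 2 ^ Suc i"
  shows "(\<Sum>v<8. inner_proof_size (U + 2 ^ Suc i * v) (Suc i) - inner_proof_size (U + 2 ^ Suc i * v) i)
    \<le> (if bit U i then 11 else 21 - 4 * (of_bool (1 \<le> i) + of_bool (2 \<le> i \<and> \<not> bit U (i - 1))))"
proof -
  define r :: real where "r = of_bool (1 \<le> i) + of_bool (2 \<le> i \<and> \<not> bit U (i - 1))"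
  have "inner_proof_size (U + 2 ^ Suc i * v) (Suc i) - inner_proof_size (U + 2 ^ Suc i * v) i
    \<le> 2 + of_bool (odd v) - of_bool (bit U i) - of_bool (boundary_bit v 0)
      + of_bool (odd v \<and> (\<not> bit U i \<or> \<not> bit v 1)) - of_bool (odd v \<and> \<not> bit U i) * r" for v
  proof -
    define T where "T = U + 2 ^ Suc i * v"
    have hi: "bit T (Suc i) = odd v" "bit T (Suc (Suc i)) = bit v 1"
      "boundary_bit T (Suc i) = boundary_bit v 0"
      using bit_add_mult_high[OF U, of v 0] bit_add_mult_high[OF U, of v 1]
        boundary_bit_high[OF U, of v 0]
      by (simp_all add: T_def bit_0)
    have lo: "bit T i = bit U i" "2 \<le> i \<Longrightarrow> bit T (i - 1) = bit U (i - 1)"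
      using bit_add_mult_low[of i "Suc i" U v] bit_add_mult_low[of "i - 1" "Suc i" U v]
      by (simp_all add: T_def)
    have "boundary_bit T i = (odd v \<and> (\<not> bit U i \<or> \<not> bit v 1))"
      by (auto simp: boundary_bit_def hi lo)
    moreover have "r \<le> real (run_length T i)" if "odd v" "\<not> bit U i"
    proof -
      have "real (of_bool (1 \<le> i) + of_bool (2 \<le> i \<and> \<not> bit T (i - 1))) \<le> real (run_length T i)"
        using that hi lo by (intro of_nat_mono run_length_ge) auto
      moreover have "(2 \<le> i \<and> \<not> bit T (i - 1)) = (2 \<le> i \<and> \<not> bit U (i - 1))"
        using lo(2) by auto
      ultimately show ?thesis by (simp add: r_def)
    qed
    ultimately show ?thesis
      unfolding T_def[symmetric] inner_proof_size_Suc hi lo by auto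
  qed
  hence "(\<Sum>v<8. inner_proof_size (U + 2 ^ Suc i * v) (Suc i) - inner_proof_size (U + 2 ^ Suc i * v) i)
    \<le> (\<Sum>v<8. 2 + of_bool (odd v) - of_bool (bit U i) - of_bool (boundary_bit v 0)
      + of_bool (odd v \<and> (\<not> bit U i \<or> \<not> bit v 1)) - of_bool (odd v \<and> \<not> bit U i) * r)"
    by (intro sum_mono)
  also have "\<dots> = (if bit U i then 11 else 21 - 4 * r)"
    by (cases "bit U i") (simp_all add: lessThan_nat_numeral boundary_bit_def bit_Suc bit_0)
  finally show ?thesis unfolding r_def .
qed

section \<open>The limit: periodic averages and an exceptional set of density zero\<close>

lemma periodic_mod: "(\<And>x. f (x + P) = f x) \<Longrightarrow> f (x mod P) = f x" for P x :: nat
proof -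
  assume per: "\<And>x. f (x + P) = f x"
  have "f (y + n * P) = f y" for y n
    by (induction n) (simp_all add: per flip: add.assoc, metis add.assoc add.commute per)
  from this[of "x mod P" "x div P"] show ?thesis by simp
qed

text \<open>After subtraction of the mean the partial sums are themselves periodic, hence
  bounded.\<close>

lemma periodic_average_tendsto:
  fixes f :: "nat \<Rightarrow> real"
  assumes per: "\<And>T. f (T + P) = f T" and "P > 0"
  shows "(\<lambda>N. (\<Sum>T = s..<s + N. f T) / real N) \<longlonglongrightarrow> (\<Sum>T<P. f T) / real P"
proof -
  define c where "c = (\<Sum>T<P. f T) / real P"
  define F where "F N = (\<Sum>T<N. f T - c)" for N
  have window: "(\<Sum>T = N..<N + P. f T) = (\<Sum>T<P. f T)" for N
  proof (induction N)
    case (Suc N)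
    have "(\<Sum>T = Suc N..<Suc N + P. f T) = (\<Sum>T = N..<N + P. f T) - f N + f (N + P)"
      using \<open>P > 0\<close> by (simp add: sum.atLeast_Suc_lessThan[of N "N + P"])
    thus ?case using Suc per by simp
  qed (simp add: lessThan_atLeast0)
  have "F (N + P) = F N" for N
  proof -
    have "F (N + P) = F N + (\<Sum>T = N..<N + P. f T - c)"
      unfolding F_def lessThan_atLeast0 by (subst sum.atLeastLessThan_concat) auto
    also have "(\<Sum>T = N..<N + P. f T - c) = 0"
      using \<open>P > 0\<close> by (simp add: sum_subtractf window) (simp add: c_def)
    finally show ?thesis by simp
  qed
  hence F_mod: "F (N mod P) = F N" for N by (rule periodic_mod)
  define C where "C = (\<Sum>r<P. \<bar>F r\<bar>)"
  have C: "\<bar>F N\<bar> \<le> C" for N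
    unfolding C_def F_mod[of N, symmetric] using \<open>P > 0\<close>
    by (intro member_le_sum[where f = "\<lambda>r. \<bar>F r\<bar>"]) auto
  have "(\<lambda>N. (F (s + N) - F s) / real N) \<longlonglongrightarrow> 0"
  proof (rule Lim_null_comparison)
    show "\<forall>\<^sub>F N in sequentially. norm ((F (s + N) - F s) / real N) \<le> 2 * C / real N"
    proof (rule always_eventually, rule allI)
      fix N
      show "norm ((F (s + N) - F s) / real N) \<le> 2 * C / real N"
        using C[of "s + N"] C[of s] by (auto simp: intro!: divide_right_mono)
    qed
    show "(\<lambda>N. 2 * C / real N) \<longlonglongrightarrow> 0" by real_asymp
  qed
  hence "(\<lambda>N. c + (F (s + N) - F s) / real N) \<longlonglongrightarrow> c + 0" by (intro tendsto_intros)
  moreover have "\<forall>\<^sub>F N in sequentially.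
      c + (F (s + N) - F s) / real N = (\<Sum>T = s..<s + N. f T) / real N"
    using eventually_gt_at_top[of 0]
  proof eventually_elim
    case (elim N)
    have "F (s + N) = F s + (\<Sum>T = s..<s + N. f T - c)"
      unfolding F_def lessThan_atLeast0 by (subst sum.atLeastLessThan_concat) auto
    thus ?case using elim by (simp add: sum_subtractf field_simps)
  qed
  ultimately show ?thesis unfolding c_def[symmetric] by (simp add: tendsto_cong)
qed

text \<open>The guard exempts the leading one. Below it no 1 stands directly above a 0, so only
  zeros followed by ones remain. The induction strips the lowest digit.\<close>

lemma no_descent_form:
  assumes "T \<ge> 1" "\<And>j. 2 ^ Suc (Suc j) \<le> T \<Longrightarrow> \<not> (bit T (Suc j) \<and> \<not> bit T j)"
  shows "\<exists>x y. Suc T = 2 ^ (x + y) + 2 ^ y"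
  using assms
proof (induction T rule: less_induct)
  case (less T)
  define S where "S = T div 2"
  show ?case
  proof (cases "T = 1")
    case True
    thus ?thesis by (intro exI[of _ 0]) simp
  next
    case False
    hence S: "1 \<le> S" "S < T" using less.prems(1) by (auto simp: S_def)
    have "\<not> (bit S (Suc j) \<and> \<not> bit S j)" if "2 ^ Suc (Suc j) \<le> S" for j
    proof -
      have "2 ^ Suc (Suc (Suc j)) \<le> T" using that by (simp add: S_def)
      from less.prems(2)[OF this] show ?thesis by (simp add: S_def bit_Suc)
    qed
    with less.IH[OF S(2,1)] obtain x y where xy: "Suc S = 2 ^ (x + y) + 2 ^ y" by blast
    show ?thesis
    proof (cases "odd T")
      case True
      hence "Suc T = 2 * Suc S" unfolding S_def by presburger
      thus ?thesis using xy by (intro exI[of _ x] exI[of _ "Suc y"]) simp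
    next
      case False
      hence T: "T = 2 * S" by (simp add: S_def)
      have "S = 1 \<or> even S"
      proof (rule ccontr)
        assume *: "\<not> (S = 1 \<or> even S)"
        hence "2 ^ Suc (Suc 0) \<le> T" using S(1) by (auto simp: T elim!: oddE)
        from less.prems(2)[OF this] show False using * by (simp add: T bit_Suc bit_0)
      qed
      thus ?thesis
      proof
        assume "S = 1"
        thus ?thesis by (intro exI[of _ 1] exI[of _ 0]) (simp add: T)
      next
        assume "even S"
        hence "odd ((2::nat) ^ (x + y) + 2 ^ y)" using xy by (metis even_Suc)
        hence "y = 0" by (cases y) auto
        thus ?thesis using xy by (intro exI[of _ "Suc x"] exI[of _ 0]) (simp add: T)
      qed
    qed
  qed
qed

text \<open>Contains every \<open>T\<close> without a range boundary to the left of mountain \<open>a\<close>: there the binary digits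
  of \<open>T\<close> are a leading one, then \<open>x\<close> zeros, then \<open>y\<close> ones.\<close>

definition sparse :: "nat \<Rightarrow> nat set" where
  "sparse a = {T. \<exists>x y. Suc (T div 2 ^ a) = 2 ^ (x + y) + 2 ^ y}"

text \<open>An element is determined by its residue and the exponents \<open>x\<close>,
  \<open>y\<close>, both at most logarithmic in \<open>M\<close>.\<close>

lemma card_sparse_le:
  "real (card (sparse a \<inter> {..M})) \<le> 2 ^ a * (log 2 (real M + 1) + 1)\<^sup>2"
proof -
  define l where "l = nat \<lfloor>log 2 (real M + 1)\<rfloor>"
  let ?g = "\<lambda>(r, x, y). 2 ^ a * (2 ^ (x + y) + 2 ^ y - 1) + r :: nat"
  have bound: "z \<le> l" if "2 ^ z \<le> Suc M" for z
  proof -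
    have "real (2 ^ z) \<le> real (Suc M)" using that by (rule of_nat_mono)
    hence "real z \<le> log 2 (real M + 1)" by (intro le_log_of_power) (simp_all add: add.commute)
    thus ?thesis unfolding l_def by linarith
  qed
  have "sparse a \<inter> {..M} \<subseteq> ?g ` ({..<2 ^ a} \<times> {..l} \<times> {..l})"
  proof
    fix T assume "T \<in> sparse a \<inter> {..M}"
    then obtain x y where T: "T \<le> M" "Suc (T div 2 ^ a) = 2 ^ (x + y) + 2 ^ y"
      by (auto simp: sparse_def)
    have "T div 2 ^ a \<le> M" using T(1) div_le_dividend order.trans by blast
    hence le: "2 ^ (x + y) + 2 ^ y \<le> Suc M" using T(2) by simp
    have "(2::nat) ^ x \<le> 2 ^ (x + y)" by (intro power_increasing) auto
    hence "x \<le> l" "y \<le> l" using le by (intro bound; linarith)+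
    moreover have "T = ?g (T mod 2 ^ a, x, y)" using T(2)[symmetric] by simp
    ultimately show "T \<in> ?g ` ({..<2 ^ a} \<times> {..l} \<times> {..l})"
      by (intro image_eqI[where x = "(T mod 2 ^ a, x, y)"]) auto
  qed
  hence "card (sparse a \<inter> {..M}) \<le> card (?g ` ({..<2 ^ a} \<times> {..l} \<times> {..l}))"
    by (intro card_mono) auto
  also have "\<dots> \<le> card ({..<(2::nat) ^ a} \<times> {..l} \<times> {..l})" by (intro card_image_le) auto
  also have "\<dots> = 2 ^ a * (Suc l)\<^sup>2" by (simp add: card_cartesian_product power2_eq_square)
  finally have "real (card (sparse a \<inter> {..M})) \<le> real (2 ^ a * (Suc l)\<^sup>2)" by (rule of_nat_mono)
  also have "\<dots> = 2 ^ a * (real l + 1)\<^sup>2" by (simp add: add.commute)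
  also have "real l \<le> log 2 (real M + 1)" unfolding l_def by simp
  hence "2 ^ a * (real l + 1)\<^sup>2 \<le> 2 ^ a * (log 2 (real M + 1) + 1)\<^sup>2"
    by (intro mult_left_mono power_mono) auto
  finally show ?thesis .
qed

text \<open>The mountain holding the \<open>k\<close>-th newest leaf, where \<open>k + 1 = 2 ^ Suc a + q\<close> with
  \<open>q < 2 ^ Suc a\<close>.\<close>

definition mountain_index :: "nat \<Rightarrow> nat \<Rightarrow> nat \<Rightarrow> nat" where
  "mountain_index a q T = (if T mod 2 ^ Suc a < q then Suc a else a)"

text \<open>The lower bound on \<open>n\<close> ensures that the mountain has a left neighbour. The
  two sizes then differ at most in the left sibling in the belt, which is missing only if no
  boundary follows to the left.\<close>

lemma proof_size_generic:
  assumes k: "k + 1 = 2 ^ Suc a + q" "q < 2 ^ Suc a" and n: "2 ^ (a + 3) \<le> Suc n"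
  shows "\<bar>real (proof_size k n) - inner_proof_size (Suc n) (mountain_index a q (Suc n))\<bar>
    \<le> of_bool (Suc n \<in> sparse (Suc a))"
proof -
  define T where "T = Suc n"
  define i where "i = mountain_index a q T"
  obtain m where m: "2 ^ m \<le> T" "T < 2 ^ Suc m"
    using ex_power_ivl1[of 2 T] by (auto simp: T_def)
  have "(2::nat) ^ (a + 3) < 2 ^ Suc m" using n m(2) by (simp add: T_def)
  hence am: "a + 3 \<le> m" by (subst (asm) power_strict_increasing_iff) auto
  have i: "i = a \<or> i = Suc a" by (simp add: i_def mountain_index_def)
  have kT: "k < T" "k \<le> n" using k n by (simp_all add: T_def power_add)
  have leaf: "T - k \<in> set (leaves (mountain_at T i))"
  proof (rule leaf_in_mountain_at[OF kT(1)])
    have "(2::nat) ^ Suc i \<le> 2 ^ (a + 3)" using i by (intro power_increasing) auto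
    thus "2 ^ Suc i \<le> T" using n by (simp add: T_def)
    show "2 ^ i + T mod 2 ^ i \<le> k"
      using k(1) mod_less_divisor[of "2 ^ a" T] unfolding i_def mountain_index_def power_Suc
      by (cases "T mod (2 * 2 ^ a) < q") (simp_all del: mod_less_divisor)
    show "k < 2 ^ Suc i + T mod 2 ^ Suc i"
      using k by (auto simp: i_def mountain_index_def)
  qed
  have im: "i < m" "Suc i < m" using am i by auto
  have eq: "real (proof_size k n) = inner_proof_size T i - 1
      + of_bool (\<exists>j\<in>{i..<m - 1}. boundary_bit T j)"
    unfolding proof_size_eq[OF m[unfolded T_def] im(1) leaf[unfolded T_def] kT(2)]
      inner_proof_size_def using im(2) by (simp only: T_def) simp
  have "T \<in> sparse (Suc a)" if none: "\<forall>j\<in>{i..<m - 1}. \<not> boundary_bit T j"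
  proof -
    define S where "S = T div 2 ^ Suc a"
    have "\<exists>x y. Suc S = 2 ^ (x + y) + 2 ^ y"
    proof (rule no_descent_form)
      have "(2::nat) ^ Suc a \<le> 2 ^ (a + 3)" by (intro power_increasing) auto
      hence "2 ^ Suc a \<le> T" using n by (simp add: T_def)
      thus "1 \<le> S" using div_le_mono[of "2 ^ Suc a" T "2 ^ Suc a"] by (simp add: S_def)
    next
      fix j assume "2 ^ Suc (Suc j) \<le> S"
      hence "2 ^ Suc (Suc j) * 2 ^ Suc a \<le> T" unfolding S_def
        by (subst (asm) less_eq_div_iff_mult_less_eq) simp_all
      hence "(2::nat) ^ (Suc a + Suc (Suc j)) < 2 ^ Suc m" using m(2)
        by (simp add: power_add mult_ac)
      hence "Suc a + Suc (Suc j) < Suc m" by (subst (asm) power_strict_increasing_iff) auto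
      hence "\<not> boundary_bit T (Suc a + j)" using none i by auto
      moreover have "bit S r = bit T (Suc a + r)" for r
        by (simp add: S_def bit_iff_odd power_add div_mult2_eq)
      ultimately show "\<not> (bit S (Suc j) \<and> \<not> bit S j)" by (auto simp: boundary_bit_def)
    qed
    thus ?thesis by (simp add: sparse_def S_def)
  qed
  thus ?thesis unfolding T_def[symmetric] i_def[symmetric] eq by auto
qed

lemma average_proof_size_tendsto:
  assumes k: "k + 1 = 2 ^ Suc a + q" "q < 2 ^ Suc a"
  shows "average_proof_size k \<longlonglongrightarrow>
    (\<Sum>T<2 ^ Suc a * 8. inner_proof_size T (mountain_index a q T)) / (2 ^ Suc a * 8)"
proof -
  define f where "f T = inner_proof_size T (mountain_index a q T)" for T
  define g where "g n = real (proof_size k n) - f (Suc n)" for n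
  \<comment> \<open>Bounds the contribution of the finitely many small \<open>n\<close> to which
    \<open>proof_size_generic\<close> does not apply.\<close>
  define C where "C = (\<Sum>n<2 ^ (a + 3). \<bar>g n\<bar>)"
  \<comment> \<open>The index is at most \<open>Suc a\<close>, so only digits up to
    \<open>a + 3\<close> matter.\<close>
  have per: "f (T + 2 ^ Suc a * 8) = f T" for T
  proof -
    have "(2::nat) ^ Suc a * 8 = 2 ^ (a + 4)" by (simp add: power_add)
    moreover have "mountain_index a q (T + 2 ^ Suc a * 8) = mountain_index a q T"
      by (simp only: mountain_index_def mod_mult_self2)
    moreover have "mountain_index a q T + 2 < a + 4" by (simp add: mountain_index_def)
    ultimately show ?thesis
      using inner_proof_size_low[of "mountain_index a q T" "a + 4" T 1] by (simp add: f_def)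
  qed
  have g_bound: "\<bar>g n\<bar> \<le> of_bool (n < 2 ^ (a + 3)) * \<bar>g n\<bar> + of_bool (Suc n \<in> sparse (Suc a))" for n
    using proof_size_generic[OF k, of n] by (cases "n < 2 ^ (a + 3)") (auto simp: g_def f_def)
  have sum_bound: "\<bar>\<Sum>n = k..<k + N. g n\<bar> \<le> C + 2 ^ Suc a * (log 2 (real (k + N) + 1) + 1)\<^sup>2" for N
  proof -
    have "\<bar>\<Sum>n = k..<k + N. g n\<bar> \<le> (\<Sum>n = k..<k + N. \<bar>g n\<bar>)" by (rule sum_abs)
    also have "\<dots> \<le> (\<Sum>n = k..<k + N. of_bool (n < 2 ^ (a + 3)) * \<bar>g n\<bar>)
        + (\<Sum>n = k..<k + N. of_bool (Suc n \<in> sparse (Suc a)))"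
      unfolding sum.distrib[symmetric] by (intro sum_mono g_bound)
    also have "(\<Sum>n = k..<k + N. of_bool (n < 2 ^ (a + 3)) * \<bar>g n\<bar>) =
        (\<Sum>n\<in>{k..<k + N} \<inter> {..<2 ^ (a + 3)}. \<bar>g n\<bar>)"
      by (subst sum.inter_restrict) (auto intro!: sum.cong simp: of_bool_def)
    also have "\<dots> \<le> C" unfolding C_def by (intro sum_mono2) auto
    also have "(\<Sum>n = k..<k + N. of_bool (Suc n \<in> sparse (Suc a))) =
        real (card ({k..<k + N} \<inter> {n. Suc n \<in> sparse (Suc a)}))" by simp
    also have "card ({k..<k + N} \<inter> {n. Suc n \<in> sparse (Suc a)}) \<le> card (sparse (Suc a) \<inter> {..k + N})"
      by (rule card_inj_on_le[where f = Suc]) auto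
    also note card_sparse_le
    finally show ?thesis by simp
  qed
  have "(\<lambda>N. (\<Sum>n = k..<k + N. g n) / real N) \<longlonglongrightarrow> 0"
  proof (rule Lim_null_comparison)
    show "\<forall>\<^sub>F N in sequentially. norm ((\<Sum>n = k..<k + N. g n) / real N)
        \<le> (C + 2 ^ Suc a * (log 2 (real (k + N) + 1) + 1)\<^sup>2) / real N"
    proof (rule always_eventually, rule allI)
      fix N
      show "norm ((\<Sum>n = k..<k + N. g n) / real N)
        \<le> (C + 2 ^ Suc a * (log 2 (real (k + N) + 1) + 1)\<^sup>2) / real N"
        using sum_bound[of N] by (simp add: divide_right_mono)
    qed
    show "(\<lambda>N. (C + 2 ^ Suc a * (log 2 (real (k + N) + 1) + 1)\<^sup>2) / real N) \<longlonglongrightarrow> 0"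
      unfolding log_def by real_asymp
  qed
  moreover have "(\<lambda>N. (\<Sum>T = Suc k..<Suc k + N. f T) / real N) \<longlonglongrightarrow>
      (\<Sum>T<2 ^ Suc a * 8. f T) / real (2 ^ Suc a * 8)"
    by (rule periodic_average_tendsto) (use per in auto)
  ultimately have "(\<lambda>N. (\<Sum>n = k..<k + N. g n) / real N + (\<Sum>T = Suc k..<Suc k + N. f T) / real N)
      \<longlonglongrightarrow> 0 + (\<Sum>T<2 ^ Suc a * 8. f T) / real (2 ^ Suc a * 8)"
    by (rule tendsto_add)
  moreover have "(\<Sum>n = k..<k + N. g n) / real N + (\<Sum>T = Suc k..<Suc k + N. f T) / real N =
      average_proof_size k N" for N
  proof -
    have "(\<Sum>T = Suc k..<Suc k + N. f T) = (\<Sum>n = k..<k + N. f (Suc n))"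
      using sum.shift_bounds_Suc_ivl[of f k "k + N"] by simp
    thus ?thesis by (simp add: average_proof_size_def g_def sum_subtractf diff_divide_distrib)
  qed
  ultimately show ?thesis by (simp add: f_def)
qed

section \<open>Bounding the mean over a period\<close>

lemma sum_inner_proof_size_index_le:
  assumes "q < 2 ^ Suc i"
  shows "(\<Sum>T<2 ^ Suc i * 8. inner_proof_size T (mountain_index i q T)) \<le>
    2 ^ i * (22 * real i + 54) - 20
    + (if q < 2 ^ i then 17 * real q else 15 * 2 ^ i + 6 + 11 * (real q - 2 ^ i))"
proof -
  define d where "d T = inner_proof_size T (Suc i) - inner_proof_size T i" for T
  define D where "D U = (\<Sum>v<8. d (U + 2 ^ Suc i * v))" for U
  have "(\<Sum>T<2 ^ Suc i * 8. inner_proof_size T (mountain_index i q T)) =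
      (\<Sum>T<2 ^ Suc i * 8. inner_proof_size T i) + (\<Sum>T<2 ^ Suc i * 8. of_bool (T mod 2 ^ Suc i < q) * d T)"
    unfolding sum.distrib[symmetric] by (intro sum.cong) (auto simp: mountain_index_def d_def)
  also have "(\<Sum>T<2 ^ Suc i * 8. inner_proof_size T i) = 2 ^ i * (22 * real i + 54) - 20"
    using sum_inner_proof_size[of i] by (simp add: mult_ac)
  also have "(\<Sum>T<2 ^ Suc i * 8. of_bool (T mod 2 ^ Suc i < q) * d T) =
      (\<Sum>v<8. \<Sum>U<2 ^ Suc i. of_bool (U < q) * d (U + 2 ^ Suc i * v))"
    unfolding sum_blocks by (intro sum.cong) auto
  also have "\<dots> = (\<Sum>U<2 ^ Suc i. of_bool (U < q) * D U)"
    by (subst sum.swap) (simp add: D_def sum_distrib_left)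
  also have "\<dots> = (\<Sum>U<q. D U)"
    using assms by (intro sum.mono_neutral_cong_right) auto
  also have "(\<Sum>U<q. D U) \<le> (if q < 2 ^ i then 17 * real q else 15 * 2 ^ i + 6 + 11 * (real q - 2 ^ i))"
  proof -
    \<comment> \<open>Digit \<open>i\<close> of \<open>U\<close> is 1 from \<open>2 ^ i\<close> on,
      which gives slope 11 there. Below, 21 improves to 17 for \<open>i \<ge> 1\<close>, and to 13
      if \<open>i \<ge> 2\<close> and digit \<open>i - 1\<close> is 0.\<close>
    have D: "D U \<le> (if bit U i then 11 else 21 - 4 * (of_bool (1 \<le> i) + of_bool (2 \<le> i \<and> \<not> bit U (i - 1))))"
      if "U < q" for U
      unfolding D_def d_def using that assms by (intro sum_inner_proof_size_diff) simp
    have bit_small: "\<not> bit U j" if "U < 2 ^ j" for U j :: nat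
      using that by (simp add: bit_iff_odd)
    have bit_top: "bit U i" if "U < q" "2 ^ i \<le> U" for U
    proof -
      have "U div 2 ^ i = 1" using that assms by (intro div_nat_eqI) auto
      thus ?thesis by (simp add: bit_iff_odd)
    qed
    show ?thesis
    proof (cases "q < 2 ^ i")
      case True
      have "D U \<le> 17" if "U < q" for U
      proof -
        have "i \<noteq> 0" using True that by (intro notI) simp
        thus ?thesis using D[OF that] bit_small[of U i] True that by (auto simp: of_bool_def split: if_splits)
      qed
      hence "(\<Sum>U<q. D U) \<le> (\<Sum>U<q. 17)" by (intro sum_mono) auto
      thus ?thesis using True by simp
    next
      case False
      have "(\<Sum>U<q. D U) = (\<Sum>U<2 ^ i. D U) + (\<Sum>U = 2 ^ i..<q. D U)"
        unfolding lessThan_atLeast0 using False by (subst sum.atLeastLessThan_concat) auto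
      also have "(\<Sum>U = 2 ^ i..<q. D U) \<le> (\<Sum>U = (2::nat) ^ i..<q. 11)"
        using D bit_top by (intro sum_mono) fastforce
      also have "\<dots> = 11 * (real q - 2 ^ i)" using False by (simp add: of_nat_diff)
      \<comment> \<open>For \<open>i \<ge> 2\<close> half of the terms are at most 13 and half at
        most 17, with mean 15. The 6 absorbs \<open>i = 0\<close>, where the single term is bounded
        by 21.\<close>
      also have "(\<Sum>U<2 ^ i. D U) \<le> 15 * 2 ^ i + 6"
      proof -
        have *: "D U \<le> 21 - 4 * (of_bool (1 \<le> i) + of_bool (2 \<le> i \<and> \<not> bit U (i - 1)))"
          if "U < 2 ^ i" for U
          using D[of U] that False bit_small[of U i] by simp
        show ?thesis
        proof (cases "i < 2")
          case True
          hence "i = 0 \<or> i = 1" by auto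
          thus ?thesis using *[of 0] *[of 1] by (auto simp: lessThan_nat_numeral lessThan_Suc)
        next
          case False
          then obtain h where h: "i = Suc h" by (cases i) auto
          have "(\<Sum>U<2 ^ i. D U) = (\<Sum>U<2 ^ h. D U) + (\<Sum>U = 2 ^ h..<2 ^ i. D U)"
            unfolding lessThan_atLeast0 by (subst sum.atLeastLessThan_concat) (auto simp: h)
          also have "(\<Sum>U<2 ^ h. D U) \<le> (\<Sum>U<(2::nat) ^ h. 13)"
          proof (rule sum_mono)
            fix U :: nat assume "U \<in> {..<2 ^ h}"
            thus "D U \<le> 13" using *[of U] False bit_small[of U h] by (simp add: h)
          qed
          also have "(\<Sum>U = 2 ^ h..<2 ^ i. D U) \<le> (\<Sum>U = (2::nat) ^ h..<2 ^ i. 17)"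
          proof (rule sum_mono)
            fix U :: nat assume "U \<in> {2 ^ h..<2 ^ i}"
            thus "D U \<le> 17" using *[of U] False by (auto simp: h of_bool_def split: if_splits)
          qed
          finally show ?thesis by (simp add: h of_nat_diff)
        qed
      qed
      finally show ?thesis using False by simp
    qed
  qed
  finally show ?thesis by simp
qed

section \<open>Comparison with the logarithm\<close>

lemma log2_chord:
  fixes x y z :: real
  assumes "0 < x" "x < y" "x \<le> z" "z \<le> y"
  shows "(y - z) * log 2 x + (z - x) * log 2 y \<le> (y - x) * log 2 z"
proof -
  define t where "t = (z - x) / (y - x)"
  have t: "0 \<le> t" "t \<le> 1" "(y - x) * t = z - x" using assms by (auto simp: t_def field_simps)
  have z: "(1 - t) * x + t * y = z" using t(3) by (simp add: algebra_simps)
  have "(1 - t) * log 2 x + t * log 2 y \<le> log 2 ((1 - t) * x + t * y)"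
    using concave_onD[OF log_concave[of 2], of t x y] t assms by simp
  hence "(y - x) * ((1 - t) * log 2 x + t * log 2 y) \<le> (y - x) * log 2 z"
    unfolding z using assms by (intro mult_left_mono) auto
  also have "(y - x) * ((1 - t) * log 2 x + t * log 2 y) =
      ((y - x) - (y - x) * t) * log 2 x + ((y - x) * t) * log 2 y"
    by (simp add: algebra_simps)
  finally show ?thesis by (simp add: t(3))
qed

text \<open>The terms of order 1/P (\<open>A\<close>, \<open>B\<close>, \<open>E\<close>) are
  compared separately from the rest. For the rest, chords of the logarithm between 1, 3/2 and 2 make
  both sides affine in \<open>p\<close> on each half.\<close>

lemma proof_size_bound_real:
  fixes P p :: real
  assumes P: "P = 2 ^ a" and p: "0 \<le> p" "p < 1"
  shows "11 / 8 * real a + 2 - 20 / (8 * P)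
     + (if p < 1 / 2 then 17 / 8 * p else 15 / 16 + 6 / (8 * P) + 11 / 8 * (p - 1 / 2))
    \<le> 11 / 8 * log 2 (P * (1 + p) / 3) + 9 / 2 - 9 / (4 * (P * (1 + p)))"
proof -
  define l :: real where "l = log 2 3"
  \<comment> \<open>The tightest requirement below, as \<open>p\<close> approaches 1, is
    \<open>log 2 3 \<le> 18 / 11\<close>; comparing \<open>3 ^ 5\<close> with \<open>2 ^ 8\<close>
    gives 8/5.\<close>
  have "l = log 2 (3 ^ 5) / 5" by (subst log_nat_power) (simp_all add: l_def)
  also have "log 2 ((3::real) ^ 5) \<le> log 2 (2 ^ 8)" by (subst log_le_cancel_iff) auto
  also have "log 2 ((2::real) ^ 8) = 8" by (subst log_nat_power) auto
  finally have l: "l \<le> 8 / 5" by simp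
  have l32: "log 2 (3 / 2) = l - 1" by (simp add: l_def log_divide)
  have P0: "P > 0" by (simp add: P)
  define A B E where "A = 9 / (4 * (P * (1 + p)))" and "B = 20 / (8 * P)" and "E = 6 / (8 * P)"
  have split: "log 2 (P * (1 + p) / 3) = real a + log 2 (1 + p) - l"
    using p P0 by (simp add: log_divide log_mult l_def P log_nat_power)
  show ?thesis
  proof (cases "p < 1 / 2")
    case True
    have "2 * (l * p) - 2 * p \<le> log 2 (1 + p)"
      using log2_chord[of 1 "3 / 2" "1 + p"] True p by (simp add: l32 algebra_simps)
    moreover have "l - 2 * (l * p) \<le> 8 / 5 - 16 / 5 * p"
      using mult_left_mono[OF l, of "1 - 2 * p"] True by (simp add: algebra_simps)
    ultimately have "17 / 8 * p + 11 / 8 * l - 5 / 2 \<le> 11 / 8 * log 2 (1 + p)"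
      using True by linarith
    moreover have "9 / (4 * (1 + p)) / P \<le> 5 / 2 / P"
      using p P0 by (intro divide_right_mono) (simp_all add: field_simps)
    hence "A \<le> B" by (simp add: A_def B_def mult_ac)
    ultimately show ?thesis unfolding split A_def[symmetric] B_def[symmetric] E_def[symmetric] if_P[OF True]
      by (simp add: field_simps)
  next
    case False
    have "2 * l - 2 * (l * p) + 4 * p - 3 \<le> log 2 (1 + p)"
      using log2_chord[of "3 / 2" 2 "1 + p"] False p by (simp add: l32 algebra_simps)
    moreover have "2 * (l * p) - l \<le> 16 / 5 * p - 8 / 5"
      using mult_left_mono[OF l, of "2 * p - 1"] False by (simp add: algebra_simps)
    ultimately have "1 / 4 + 11 / 8 * p + 11 / 8 * l - 5 / 2 \<le> 11 / 8 * log 2 (1 + p)"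
      using p by linarith
    \<comment> \<open>7/4 is what \<open>E\<close>, that is 3/4 over \<open>P\<close>, leaves of
      \<open>B\<close>, that is 5/2 over \<open>P\<close>.\<close>
    moreover have "9 / (4 * (1 + p)) / P \<le> 7 / 4 / P"
      using False P0 by (intro divide_right_mono) (simp_all add: field_simps)
    hence "A + E \<le> B" by (simp add: A_def B_def E_def mult_ac)
    ultimately show ?thesis unfolding split A_def[symmetric] B_def[symmetric] E_def[symmetric] if_not_P[OF False]
      by (simp add: field_simps)
  qed
qed

theorem theorem3:
  fixes k :: nat
  assumes "k \<ge> 1"
  shows "convergent (average_proof_size k) \<and>
    expected_proof_size k \<le>
      11 / 8 * log 2 ((real k + 1) / 3) + 9 / 2 - 9 / (4 * (real k + 1))"
proof -
  obtain a where a: "2 ^ a \<le> k + 1" "k + 1 < 2 ^ Suc a"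
    using ex_power_ivl1[of 2 "k + 1"] by auto
  \<comment> \<open>Ensures that there is a mountain index \<open>a - 1\<close>.\<close>
  have "a \<noteq> 0" using a(2) assms by (intro notI) simp
  then obtain i where i: "a = Suc i" by (cases a) auto
  define q where "q = k + 1 - 2 ^ Suc i"
  have k: "k + 1 = 2 ^ Suc i + q" and q: "q < 2 ^ Suc i"
    using a by (simp_all add: q_def i)
  let ?S = "\<Sum>T<2 ^ Suc i * 8. inner_proof_size T (mountain_index i q T)"
  have lim: "average_proof_size k \<longlonglongrightarrow> ?S / (2 ^ Suc i * 8)"
    by (rule average_proof_size_tendsto[OF k q])
  define P p :: real where "P = 2 ^ Suc i" and "p = real q / P"
  have P0: "P > 0" by (simp add: P_def)
  have qP: "real q = P * p" and half: "2 ^ i = P / 2" using P0 by (simp_all add: p_def P_def)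
  have less: "q < 2 ^ i \<longleftrightarrow> p < 1 / 2"
  proof -
    have "q < 2 ^ i \<longleftrightarrow> real q < 2 ^ i" using of_nat_less_iff[of q "2 ^ i", where 'a = real] by simp
    thus ?thesis using P0 by (simp add: half p_def field_simps)
  qed
  have p: "0 \<le> p" "p < 1"
  proof -
    have "real q < real (2 ^ Suc i)" using q by (rule of_nat_less_iff[THEN iffD2])
    thus "0 \<le> p" "p < 1" by (simp_all add: p_def P_def)
  qed
  have kP: "real k + 1 = P * (1 + p)"
  proof -
    have "real (k + 1) = real (2 ^ Suc i + q)" using k by (rule arg_cong)
    thus ?thesis using P0 by (simp add: p_def P_def algebra_simps)
  qed
  have "?S / (2 ^ Suc i * 8) \<le> (2 ^ i * (22 * real i + 54) - 20
    + (if q < 2 ^ i then 17 * real q else 15 * 2 ^ i + 6 + 11 * (real q - 2 ^ i))) / (2 ^ Suc i * 8)"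
    by (intro divide_right_mono sum_inner_proof_size_index_le q) simp
  also have "\<dots> = 11 / 8 * real (Suc i) + 2 - 20 / (8 * P)
     + (if p < 1 / 2 then 17 / 8 * p else 15 / 16 + 6 / (8 * P) + 11 / 8 * (p - 1 / 2))"
    unfolding less P_def[symmetric] half qP using P0 by (simp add: field_simps)
  also have "\<dots> \<le> 11 / 8 * log 2 ((real k + 1) / 3) + 9 / 2 - 9 / (4 * (real k + 1))"
    unfolding kP by (rule proof_size_bound_real[OF P_def p])
  finally show ?thesis
    using lim by (auto simp: expected_proof_size_def limI convergent_def)
qed

end
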